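(* Let $\mathcal H$ be a real Hilbert space, let $\mu\in\,]0,\infty[$, let $n\ge 1$ be an integer, $I=\{1,\dots,n\}$, and let $\lambda_i>0$ ($i\in I$) satisfy $\sum_{i\in I}\lambda_i=1$. Suppose that for each $i\in I$, $f_i:\mathcal H\to\,]-\infty,+\infty]$ is proper, lower semicontinuous and convex, and set $A_i=\partial f_i$. Suppose further that there exists $\varnothing\neq I_0\subseteq I$ such that for every $i\in I_0$, $f_i$ is Fréchet differentiable on $\mathcal H$ and $\nabla f_i$ is $\epsilon_i$-Lipschitz, and for every $i\notin I_0$ set $\epsilon_i=\infty$. Write $\mathbf f=(f_1,\dots,f_n)$, $\mathbf A=(A_1,\dots,A_n)$, $\boldsymbol\lambda=(\lambda_1,\dots,\lambda_n)$. Then $p_\mu(\mathbf f,\boldsymbol\lambda)$ is Fréchet differentiable on $\mathcal H$, and $\mathcal R_\mu(\mathbf A,\boldsymbol\lambda)=\nabla p_\mu(\mathbf f,\boldsymbol\lambda)$ is $\epsilon$-Lipschitz, where $$\epsilon=r_\mu(\boldsymbol\epsilon,\boldsymbol\lambda)=\Big[\sum_{i\in I}\lambda_i(\epsilon_i+\mu^{-1})^{-1}\Big]^{-1}-\mu^{-1}.$$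
   Context: Convention in $[0,\infty]$: $\infty^{-1}=0$ (so terms with $\epsilon_i=\infty$ contribute $0$ to the sum), $0^{-1}=\infty$, $0\cdot\infty=0$. A mapping is $L$-Lipschitz if it is Lipschitz continuous with constant $L$ (finite). $\partial f$ is the convex subdifferential. The $\boldsymbol\lambda$-weighted proximal average of $\mathbf f$ with parameter $\mu$ is the function $$p_\mu(\mathbf f,\boldsymbol\lambda)(x)=\frac1\mu\Big(-\frac12\|x\|^2+\inf_{\sum_{i\in I}x_i=x}\sum_{i\in I}\lambda_i\big(\mu f_i(x_i/\lambda_i)+\tfrac12\|x_i/\lambda_i\|^2\big)\Big),\quad x\in\mathcal H.$$ The $\boldsymbol\lambda$-weighted resolvent average of $\mathbf A$ with parameter $\mu$ is the set-valued mapping $$\mathcal R_\mu(\mathbf A,\boldsymbol\lambda)=\Big(\sum_{i\in I}\lambda_i(A_i+\mu^{-1}\mathrm{Id})^{-1}\Big)^{-1}-\mu^{-1}\mathrm{Id},$$ where inverses are set-valued inverses ($x\in A^{-1}u\Leftrightarrow u\in Ax$), sums and multiples are pointwise Minkowski operations, and $\mathrm{Id}$ is the identity; a single-valued everywhere defined mapping is identified with a function $\mathcal H\to\mathcal H$. *)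

theory Defs
  imports "HOL-Analysis.Analysis" "HOL-Library.Set_Algebras"
begin

subsection \<open>Extended-real-valued functions\<close>

definition proper_fun :: "('a \<Rightarrow> ereal) \<Rightarrow> bool" where
  "proper_fun f \<longleftrightarrow> (\<forall>x. f x \<noteq> -\<infinity>) \<and> (\<exists>x. f x \<noteq> \<infinity>)"

definition lsc_fun :: "('a::topological_space \<Rightarrow> ereal) \<Rightarrow> bool" where
  "lsc_fun f \<longleftrightarrow> (\<forall>x. f x \<le> Liminf (nhds x) f)"

definition convex_fun :: "('a::real_vector \<Rightarrow> ereal) \<Rightarrow> bool" where
  "convex_fun f \<longleftrightarrow> (\<forall>x y. \<forall>t\<in>{0<..<1::real}.
     f ((1 - t) *\<^sub>R x + t *\<^sub>R y) \<le> ereal (1 - t) * f x + ereal t * f y)"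

definition subdifferential :: "('a::real_inner \<Rightarrow> ereal) \<Rightarrow> 'a \<Rightarrow> 'a set" where
  "subdifferential f x = {u. \<forall>y. f x + ereal (inner (y - x) u) \<le> f y}"

text \<open>An extended-real-valued function that is differentiable on the whole space is in
  particular finite everywhere, so passing to its real part loses nothing.\<close>

definition frechet_differentiable :: "('a::real_normed_vector \<Rightarrow> ereal) \<Rightarrow> bool" where
  "frechet_differentiable f \<longleftrightarrow>
     (\<forall>x. \<bar>f x\<bar> \<noteq> \<infinity>) \<and> (\<forall>x. (\<lambda>y. real_of_ereal (f y)) differentiable (at x))"

text \<open>The gradient is the Riesz representative of the Frechet derivative; on a Hilbert space
  it exists and is unique wherever the function is differentiable.\<close>

definition gradient :: "('a::real_inner \<Rightarrow> ereal) \<Rightarrow> 'a \<Rightarrow> 'a" where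
  "gradient f x = (THE g. GDERIV (\<lambda>y. real_of_ereal (f y)) x :> g)"

text \<open>Lipschitz constants live in the extended reals (so that infinity can be used as a
  parameter), but being Lipschitz always means with a finite constant.\<close>

definition lipschitz_with :: "ereal \<Rightarrow> ('a::metric_space \<Rightarrow> 'b::metric_space) \<Rightarrow> bool" where
  "lipschitz_with e g \<longleftrightarrow> (\<exists>L. e = ereal L \<and> L-lipschitz_on UNIV g)"

subsection \<open>Set-valued mappings\<close>

text \<open>Addition of sets below is Minkowski addition, from \<^theory>\<open>HOL-Library.Set_Algebras\<close>.\<close>

definition sv_inverse :: "('a \<Rightarrow> 'b set) \<Rightarrow> 'b \<Rightarrow> 'a set" where
  "sv_inverse A u = {x. u \<in> A x}"

definition sv_id :: "'a \<Rightarrow> 'a set" where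
  "sv_id x = {x}"

definition sv_add :: "('a \<Rightarrow> 'b::plus set) \<Rightarrow> ('a \<Rightarrow> 'b set) \<Rightarrow> 'a \<Rightarrow> 'b set" where
  "sv_add A B x = A x + B x"

definition sv_scale :: "real \<Rightarrow> ('a \<Rightarrow> 'b::real_vector set) \<Rightarrow> 'a \<Rightarrow> 'b set" where
  "sv_scale c A x = (\<lambda>u. c *\<^sub>R u) ` A x"

subsection \<open>The averages\<close>

definition proximal_average ::
    "real \<Rightarrow> 'i set \<Rightarrow> ('i \<Rightarrow> 'a::real_inner \<Rightarrow> ereal) \<Rightarrow> ('i \<Rightarrow> real) \<Rightarrow> 'a \<Rightarrow> ereal" where
  "proximal_average \<mu> I f w x =
     ereal (1 / \<mu>) *
       (ereal (- (1/2) * (norm x)\<^sup>2) +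
        (INF y\<in>{y :: 'i \<Rightarrow> 'a. (\<Sum>i\<in>I. y i) = x}.
           \<Sum>i\<in>I. ereal (w i) *
             (ereal \<mu> * f i (y i /\<^sub>R w i) + ereal (1/2 * (norm (y i /\<^sub>R w i))\<^sup>2))))"

definition resolvent_average ::
    "real \<Rightarrow> 'i set \<Rightarrow> ('i \<Rightarrow> 'a::real_vector \<Rightarrow> 'a set) \<Rightarrow> ('i \<Rightarrow> real) \<Rightarrow> 'a \<Rightarrow> 'a set" where
  "resolvent_average \<mu> I A w =
     sv_add
       (sv_inverse
         (\<lambda>u. \<Sum>i\<in>I. sv_scale (w i) (sv_inverse (sv_add (A i) (sv_scale (inverse \<mu>) sv_id))) u))
       (sv_scale (- inverse \<mu>) sv_id)"

text \<open>On \<^typ>\<open>ereal\<close> the library has \<open>inverse \<infinity> = 0\<close>, \<open>inverse 0 = \<infinity>\<close> and \<open>0 * \<infinity> = 0\<close>,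
  as needed here.\<close>

definition harmonic_const :: "real \<Rightarrow> 'i set \<Rightarrow> ('i \<Rightarrow> ereal) \<Rightarrow> ('i \<Rightarrow> real) \<Rightarrow> ereal" where
  "harmonic_const \<mu> I e w =
     inverse (\<Sum>i\<in>I. ereal (w i) * inverse (e i + ereal (inverse \<mu>))) - ereal (inverse \<mu>)"

end

theory Submission
  imports Defs
begin

text \<open>
  For each \<open>i\<close> let \<open>P\<^sub>i = (A\<^sub>i + \<mu>\<^sup>-\<^sup>1 Id)\<^sup>-\<^sup>1\<close>. By the existence of proximal points, \<open>P\<^sub>i\<close> is a
  single-valued, everywhere defined mapping (\<open>resolvent_exists\<close>, \<open>resolvent_unique\<close>), and it
  satisfies \<open>\<langle>P\<^sub>i u - P\<^sub>i v, u - v\<rangle> \<ge> \<mu>\<^sup>-\<^sup>1 |P\<^sub>i u - P\<^sub>i v|\<^sup>2\<close>. If \<open>\<nabla>f\<^sub>i\<close> is \<open>\<epsilon>\<^sub>i\<close>-Lipschitz, then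
  \<open>P\<^sub>i\<close> inverts the gradient \<open>\<nabla>f\<^sub>i + \<mu>\<^sup>-\<^sup>1 Id\<close> of a convex function, which is
  \<open>(\<epsilon>\<^sub>i + \<mu>\<^sup>-\<^sup>1)\<close>-Lipschitz, so by the Baillon-Haddad theorem \<open>P\<^sub>i\<close> is strongly monotone with modulus
  \<open>(\<epsilon>\<^sub>i + \<mu>\<^sup>-\<^sup>1)\<^sup>-\<^sup>1\<close> (\<open>resolvent_strongly_monotone\<close>). Averaging, \<open>T = \<Sum>\<^sub>i w\<^sub>i P\<^sub>i\<close> is strongly monotone
  with modulus \<open>c = \<Sum>\<^sub>i w\<^sub>i (\<epsilon>\<^sub>i + \<mu>\<^sup>-\<^sup>1)\<^sup>-\<^sup>1\<close>, which is positive as soon as one \<open>\<epsilon>\<^sub>i\<close> is finite, and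
  \<open>T\<close> inherits the other inequality. Hence \<open>T\<close> is a bijection, \<open>Q = T\<^sup>-\<^sup>1\<close> is \<open>c\<^sup>-\<^sup>1\<close>-Lipschitz, and
  the resolvent average is the single-valued mapping \<open>R = Q - \<mu>\<^sup>-\<^sup>1 Id\<close>.

  On the side of functions, put \<open>u = Q x\<close>. Since \<open>u\<close> is a subgradient of
  \<open>f\<^sub>i + |.|\<^sup>2/(2\<mu>)\<close> at \<open>P\<^sub>i u\<close> for every \<open>i\<close>, the points \<open>x\<^sub>i = w\<^sub>i P\<^sub>i u\<close> attain the infimum that
  defines the proximal average \<open>p\<close> at \<open>x\<close> (\<open>proximal_average_eq\<close>). With \<open>H = p + |.|\<^sup>2/(2\<mu>)\<close>, the
  same subgradient inequalities give \<open>H y \<ge> H x + \<langle>y - x, Q x\<rangle>\<close>; as \<open>Q\<close> is Lipschitz, \<open>H\<close> is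
  differentiable with gradient \<open>Q\<close>, and therefore \<open>\<nabla>p = R\<close>.

  For the sharp constant, the inequalities for \<open>T\<close> show
  \<open>0 \<le> \<langle>x - y, R x - R y\<rangle> \<le> (c\<^sup>-\<^sup>1 - \<mu>\<^sup>-\<^sup>1) |x - y|\<^sup>2\<close>. These two bounds alone do not make a mapping
  Lipschitz with constant \<open>c\<^sup>-\<^sup>1 - \<mu>\<^sup>-\<^sup>1\<close>, but they do so for a gradient, again by Baillon-Haddad
  (\<open>GDERIV_monotone_imp_lipschitz\<close>).
\<close>

section \<open>Proximal points of convex functions\<close>

lemma proper_funE:
  assumes "proper_fun f" "f x \<noteq> \<infinity>"
  obtains a where "f x = ereal a"
  using assms by (cases "f x") (auto simp: proper_fun_def)

lemma lsc_fun_eventually_greater: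
  assumes "lsc_fun f" "y < f x"
  shows "eventually (\<lambda>z. y < f z) (nhds x)"
  using assms less_le_trans less_LiminfD unfolding lsc_fun_def by metis

lemma convex_fun_combination_le:
  assumes "convex_fun f" "f x = ereal a" "f y = ereal b" "0 \<le> t" "t \<le> 1"
  shows "f ((1 - t) *\<^sub>R x + t *\<^sub>R y) \<le> ereal ((1 - t) * a + t * b)"
proof (cases "t = 0 \<or> t = 1")
  case True
  then show ?thesis using assms by auto
next
  case False
  then have "t \<in> {0<..<1}" using assms by auto
  then have "f ((1 - t) *\<^sub>R x + t *\<^sub>R y) \<le> ereal (1 - t) * f x + ereal t * f y"
    using assms(1) unfolding convex_fun_def by blast
  then show ?thesis using assms by simp
qed

text \<open>A lower bound of linear growth. Near a point \<open>x0\<close> of the domain, lower semicontinuity bounds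
  \<open>f\<close> from below; convexity along the segment from \<open>x0\<close> to \<open>z\<close> carries the bound to distant \<open>z\<close>.
  It replaces the affine minorant provided by the Hahn-Banach theorem.\<close>

lemma convex_lsc_conic_minorant:
  fixes f :: "'a::real_normed_vector \<Rightarrow> ereal"
  assumes f: "proper_fun f" "lsc_fun f" "convex_fun f"
  shows "\<exists>x0 m k. k \<ge> 0 \<and> (\<forall>z. ereal (m - k * norm (z - x0)) \<le> f z)"
proof -
  obtain x0 where "f x0 \<noteq> \<infinity>" using f(1) by (auto simp: proper_fun_def)
  then obtain a where a: "f x0 = ereal a" using proper_funE f(1) by metis
  have "ereal (a - 1) < f x0" by (simp add: a)
  from lsc_fun_eventually_greater[OF f(2) this]
  obtain r where r: "r > 0" "\<And>z. dist z x0 < r \<Longrightarrow> ereal (a - 1) < f z"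
    unfolding eventually_nhds_metric by blast
  have "ereal (a - 1 - 2 / r * norm (z - x0)) \<le> f z" for z
  proof (cases "f z = \<infinity>")
    case False
    then obtain b where b: "f z = ereal b" using proper_funE f(1) by metis
    have nn: "2 / r * norm (z - x0) \<ge> 0" using r by simp
    show ?thesis
    proof (cases "dist z x0 < r")
      case True
      then have "a - 1 < b" using r(2)[OF True] b by simp
      then show ?thesis using b nn by simp
    next
      case False
      define s where "s = norm (z - x0)"
      have s: "s \<ge> r" using False by (simp add: s_def dist_norm)
      \<comment> \<open>the point of the segment from \<open>x0\<close> to \<open>z\<close> at distance \<open>r / 2\<close> from \<open>x0\<close>\<close>
      define t where "t = r / (2 * s)"
      have t: "0 < t" "t \<le> 1" using r s by (auto simp: t_def field_simps)
      have "(1 - t) *\<^sub>R x0 + t *\<^sub>R z - x0 = t *\<^sub>R (z - x0)" by (simp add: algebra_simps)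
      then have "dist ((1 - t) *\<^sub>R x0 + t *\<^sub>R z) x0 = t * s"
        using t by (simp add: dist_norm s_def)
      also have "\<dots> < r" using r s by (simp add: t_def)
      finally have "ereal (a - 1) < f ((1 - t) *\<^sub>R x0 + t *\<^sub>R z)" by (rule r(2))
      also have "\<dots> \<le> ereal ((1 - t) * a + t * b)"
        using convex_fun_combination_le[OF f(3) a b] t by simp
      finally have "a - 1 < (1 - t) * a + t * b" by simp
      then have "a - b < 1 / t" using t by (simp add: field_simps)
      then have "a - b < 2 / r * s" using r s by (simp add: t_def)
      then show ?thesis using b by (simp add: s_def)
    qed
  qed simp
  then show ?thesis using r by (intro exI[of _ x0] exI[of _ "a - 1"] exI[of _ "2 / r"]) simp
qed

lemma norm_midpoint_diff_sq:
  fixes x y a :: "'a::real_inner"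
  shows "(norm ((1 - 1/2) *\<^sub>R x + (1/2) *\<^sub>R y - a))\<^sup>2
    = (norm (x - a))\<^sup>2 / 2 + (norm (y - a))\<^sup>2 / 2 - (norm (x - y))\<^sup>2 / 4"
  by (simp add: power2_norm_eq_inner algebra_simps inner_commute) (simp add: field_simps inner_commute)

text \<open>The proximal objective is bounded below, as its quadratic term dominates the linear growth
  bound. By the parallelogram identity it is uniformly convex, so minimizing sequences are Cauchy,
  and lower semicontinuity makes their limit a minimizer.\<close>

lemma proximal_minimizer_exists:
  fixes f :: "'a::{real_inner, complete_space} \<Rightarrow> ereal"
  assumes f: "proper_fun f" "lsc_fun f" "convex_fun f" and "\<mu> > 0"
  shows "\<exists>z. f z \<noteq> \<infinity> \<and>
    (\<forall>y. f z + ereal ((norm (z - a))\<^sup>2 / (2 * \<mu>)) \<le> f y + ereal ((norm (y - a))\<^sup>2 / (2 * \<mu>)))"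
proof -
  define F where "F = (\<lambda>z. real_of_ereal (f z))"
  define D where "D = {z. f z \<noteq> \<infinity>}"
  have F: "f z = ereal (F z)" if "z \<in> D" for z
    using that f(1) by (auto simp: F_def D_def elim!: proper_funE)
  define \<phi> where "\<phi> = (\<lambda>z. F z + (norm (z - a))\<^sup>2 / (2 * \<mu>))"
  have Dne: "D \<noteq> {}" using f(1) by (auto simp: D_def proper_fun_def)
  obtain x0 m k where k: "k \<ge> 0" "\<And>z. ereal (m - k * norm (z - x0)) \<le> f z"
    using convex_lsc_conic_minorant[OF f] by blast
  have low: "m - k * norm (a - x0) - k\<^sup>2 * \<mu> / 2 \<le> \<phi> z" if "z \<in> D" for z
  proof -
    define s where "s = norm (z - a)"
    have "norm (z - x0) \<le> s + norm (a - x0)"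
      using norm_triangle_ineq[of "z - a" "a - x0"] by (simp add: s_def)
    from mult_left_mono[OF this k(1)] have 1: "k * norm (z - x0) \<le> k * s + k * norm (a - x0)"
      by (simp add: algebra_simps)
    have 2: "m - k * norm (z - x0) \<le> F z" using k(2)[of z] F[OF that] by simp
    have "0 \<le> (s - k * \<mu>)\<^sup>2 / (2 * \<mu>)" using assms by simp
    then have "k * s \<le> s\<^sup>2 / (2 * \<mu>) + k\<^sup>2 * \<mu> / 2"
      using assms by (simp add: power2_eq_square field_simps)
    then show ?thesis using 1 2 by (simp add: \<phi>_def s_def)
  qed
  then have bdd: "bdd_below (\<phi> ` D)" by (auto intro!: bdd_belowI2)
  define l where "l = Inf (\<phi> ` D)"
  have l: "l \<le> \<phi> z" if "z \<in> D" for z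
    unfolding l_def using bdd that by (intro cInf_lower) auto
  have "\<exists>z\<in>D. \<phi> z < l + e" if "e > 0" for e
    using cInf_lessD[of "\<phi> ` D" "l + e"] Dne that by (auto simp: l_def)
  then have "\<forall>n. \<exists>z\<in>D. \<phi> z < l + 1 / real (Suc n)" by simp
  then obtain Z where Z: "\<And>n. Z n \<in> D" "\<And>n. \<phi> (Z n) < l + 1 / real (Suc n)" by metis
  have mid: "(norm (x - y))\<^sup>2 \<le> 8 * \<mu> * ((\<phi> x + \<phi> y) / 2 - l)" if "x \<in> D" "y \<in> D" for x y
  proof -
    let ?p = "(1 - 1/2) *\<^sub>R x + (1/2) *\<^sub>R y"
    have le: "f ?p \<le> ereal ((1 - 1/2) * F x + (1/2) * F y)"
      using convex_fun_combination_le[OF f(3) F[OF that(1)] F[OF that(2)], of "1/2"] by simp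
    then have pD: "?p \<in> D" by (auto simp: D_def)
    have "F ?p \<le> (F x + F y) / 2" using le F[OF pD] by simp
    then have "\<phi> ?p \<le> (\<phi> x + \<phi> y) / 2 - (norm (x - y))\<^sup>2 / (8 * \<mu>)"
      unfolding \<phi>_def norm_midpoint_diff_sq by (simp add: add_divide_distrib diff_divide_distrib)
    then have "(norm (x - y))\<^sup>2 / (8 * \<mu>) \<le> (\<phi> x + \<phi> y) / 2 - l" using l[OF pD] by simp
    then show ?thesis using assms by (simp add: field_simps)
  qed
  have "Cauchy Z"
  proof (rule metric_CauchyI)
    fix e :: real assume e: "e > 0"
    then obtain N where N: "1 / real (Suc N) < e\<^sup>2 / (8 * \<mu>)"
      using assms nat_approx_posE[of "e\<^sup>2 / (8 * \<mu>)"] by auto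
    have "dist (Z i) (Z j) < e" if "i \<ge> N" "j \<ge> N" for i j
    proof -
      have tail: "\<phi> (Z i) < l + 1 / real (Suc N)" if "i \<ge> N" for i
      proof -
        have "1 / real (Suc i) \<le> 1 / real (Suc N)" using that by (simp add: field_simps)
        then show ?thesis using Z(2)[of i] by linarith
      qed
      have "(\<phi> (Z i) + \<phi> (Z j)) / 2 - l < e\<^sup>2 / (8 * \<mu>)"
        using tail[OF that(1)] tail[OF that(2)] N by argo
      then have "8 * \<mu> * ((\<phi> (Z i) + \<phi> (Z j)) / 2 - l) < e\<^sup>2"
        using assms by (simp add: field_simps)
      then have "(norm (Z i - Z j))\<^sup>2 < e\<^sup>2" using mid[OF Z(1) Z(1), of i j] by linarith
      then show ?thesis using e power_less_imp_less_base by (fastforce simp: dist_norm)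
    qed
    then show "\<exists>M. \<forall>i\<ge>M. \<forall>j\<ge>M. dist (Z i) (Z j) < e" by blast
  qed
  then obtain z where z: "Z \<longlonglongrightarrow> z" using Cauchy_convergent convergent_def by blast
  define c where "c = l - (norm (z - a))\<^sup>2 / (2 * \<mu>)"
  \<comment> \<open>\<open>f z\<close> may still be infinite here, hence the comparison in the extended reals\<close>
  have fz: "f z \<le> ereal c"
  proof (rule ccontr)
    assume "\<not> f z \<le> ereal c"
    then have "ereal c < f z" by simp
    from ereal_dense2[OF this] obtain d where d: "ereal c < ereal d" "ereal d < f z" by blast
    have "eventually (\<lambda>n. ereal d < f (Z n)) sequentially"
      using lsc_fun_eventually_greater[OF f(2) d(2)] z
      by (rule eventually_compose_filterlim)
    then have ev: "eventually (\<lambda>n. d \<le> l + 1 / real (Suc n) - (norm (Z n - a))\<^sup>2 / (2 * \<mu>)) sequentially"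
    proof eventually_elim
      case (elim n)
      then have "d < F (Z n)" using F[OF Z(1)[of n]] by simp
      then show ?case using Z(2)[of n] by (simp add: \<phi>_def)
    qed
    have "(\<lambda>n. l + 1 / real (Suc n) - (norm (Z n - a))\<^sup>2 / (2 * \<mu>))
        \<longlonglongrightarrow> l + 0 - (norm (z - a))\<^sup>2 / (2 * \<mu>)"
      using z by (intro tendsto_intros LIMSEQ_Suc lim_const_over_n) (use assms in auto)
    from tendsto_lowerbound[OF this ev] have "d \<le> c" by (simp add: c_def)
    then show False using d by simp
  qed
  then have zD: "z \<in> D" by (auto simp: D_def)
  have "\<phi> z \<le> l" using fz F[OF zD] by (simp add: \<phi>_def c_def)
  then have "f z + ereal ((norm (z - a))\<^sup>2 / (2 * \<mu>)) \<le> f y + ereal ((norm (y - a))\<^sup>2 / (2 * \<mu>))" for y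
  proof (cases "y \<in> D")
    case True
    then show ?thesis using \<open>\<phi> z \<le> l\<close> l[OF True] F[OF zD] F[OF True] by (simp add: \<phi>_def)
  qed (auto simp: D_def)
  then show ?thesis using zD by (auto simp: D_def)
qed

text \<open>Surjectivity of \<open>Id + \<mu> \<partial>f\<close>: the minimizer satisfies the first order condition.\<close>

lemma proximal_point_exists:
  fixes f :: "'a::{real_inner, complete_space} \<Rightarrow> ereal"
  assumes f: "proper_fun f" "lsc_fun f" "convex_fun f" and \<mu>: "\<mu> > 0"
  shows "\<exists>z. (1 / \<mu>) *\<^sub>R (a - z) \<in> subdifferential f z"
proof -
  obtain z where z: "f z \<noteq> \<infinity>"
    "\<And>y. f z + ereal ((norm (z - a))\<^sup>2 / (2 * \<mu>)) \<le> f y + ereal ((norm (y - a))\<^sup>2 / (2 * \<mu>))"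
    using proximal_minimizer_exists[OF assms] by blast
  obtain b where b: "f z = ereal b" using z(1) f(1) proper_funE by metis
  have "f z + ereal (inner (y - z) ((1 / \<mu>) *\<^sub>R (a - z))) \<le> f y" for y
  proof (cases "f y = \<infinity>")
    case False
    then obtain c where c: "f y = ereal c" using f(1) proper_funE by metis
    define p where "p = inner (y - z) (z - a) / \<mu>"
    define q where "q = (norm (y - z))\<^sup>2 / (2 * \<mu>)"
    \<comment> \<open>compare \<open>z\<close> with \<open>z + t (y - z)\<close>, divide by \<open>t\<close> and let \<open>t\<close> tend to \<open>0\<close>\<close>
    have "0 \<le> c - b + p + t * q" if "0 < t" "t < 1" for t
    proof -
      let ?w = "(1 - t) *\<^sub>R z + t *\<^sub>R y"
      have "f ?w \<le> ereal ((1 - t) * b + t * c)"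
        using convex_fun_combination_le[OF f(3) b c] that by simp
      then have "f z + ereal ((norm (z - a))\<^sup>2 / (2 * \<mu>))
          \<le> ereal ((1 - t) * b + t * c) + ereal ((norm (?w - a))\<^sup>2 / (2 * \<mu>))"
        using z(2)[of ?w] by (meson add_right_mono order_trans)
      then have 1: "b + (norm (z - a))\<^sup>2 / (2 * \<mu>)
          \<le> (1 - t) * b + t * c + (norm (?w - a))\<^sup>2 / (2 * \<mu>)" by (simp add: b)
      have 2: "?w - a = (z - a) + t *\<^sub>R (y - z)" by (simp add: algebra_simps)
      have "(norm (?w - a))\<^sup>2
          = (norm (z - a))\<^sup>2 + 2 * t * inner (y - z) (z - a) + t\<^sup>2 * (norm (y - z))\<^sup>2"
        unfolding 2 power2_norm_eq_inner inner_add_left inner_add_right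
        by (simp add: inner_commute power2_eq_square)
      then have "(norm (?w - a))\<^sup>2 / (2 * \<mu>) = (norm (z - a))\<^sup>2 / (2 * \<mu>) + t * p + t\<^sup>2 * q"
        using \<mu> by (simp add: p_def q_def add_divide_distrib)
      with 1 have "0 \<le> t * (c - b) + t * p + t\<^sup>2 * q"
        by (simp add: algebra_simps)
      then have "0 \<le> t * (c - b + p + t * q)" by (simp add: algebra_simps power2_eq_square)
      then show ?thesis using that by (simp add: zero_le_mult_iff)
    qed
    then have ev: "eventually (\<lambda>t. 0 \<le> c - b + p + t * q) (at_right 0)"
      by (auto simp: eventually_at_right_field intro!: exI[of _ 1])
    have "((\<lambda>t. c - b + p + t * q) \<longlongrightarrow> c - b + p + 0 * q) (at_right 0)"
      by (intro tendsto_intros)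
    from tendsto_lowerbound[OF this ev] have "0 \<le> c - b + p" by simp
    then show ?thesis using b c
      by (simp add: p_def inner_diff_right diff_divide_distrib)
  qed simp
  then show ?thesis by (auto simp: subdifferential_def)
qed

section \<open>Gradients of convex functions\<close>

lemma GDERIV_unique:
  assumes "GDERIV F x :> a" "GDERIV F x :> b"
  shows "a = b"
proof -
  have "(\<lambda>h. inner h a) = (\<lambda>h. inner h b)"
    using assms has_derivative_unique unfolding gderiv_def by blast
  then have "inner (a - b) a = inner (a - b) b" by metis
  then have "inner (a - b) (a - b) = 0" by (simp add: inner_diff_right)
  then show ?thesis by simp
qed

lemma gradient_eqI: "GDERIV (\<lambda>y. real_of_ereal (f y)) x :> g \<Longrightarrow> gradient f x = g"
  unfolding gradient_def using GDERIV_unique by blast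

text \<open>A proximal point of the linear function \<open>- D\<close> at the origin is the vector representing \<open>D\<close>.\<close>

lemma Riesz_representation:
  fixes D :: "'a::{real_inner, complete_space} \<Rightarrow> real"
  assumes "bounded_linear D"
  shows "\<exists>g. \<forall>x. D x = inner x g"
proof -
  interpret D: bounded_linear D by fact
  define f where "f = (\<lambda>x. ereal (- D x))"
  have "proper_fun f" by (simp add: f_def proper_fun_def)
  moreover have "lsc_fun f"
  proof -
    have "isCont D x" for x by (rule D.isCont) simp
    then have "(f \<longlongrightarrow> f x) (nhds x)" for x
      unfolding f_def by (intro tendsto_intros) (simp add: isCont_def tendsto_at_iff_tendsto_nhds)
    then have "Liminf (nhds x) f = f x" for x
      by (intro lim_imp_Liminf) auto
    then show ?thesis by (simp add: lsc_fun_def)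
  qed
  moreover have "convex_fun f"
    by (simp add: convex_fun_def f_def D.add D.scaleR)
  ultimately obtain z where "(1 / 1) *\<^sub>R (0 - z) \<in> subdifferential f z"
    using proximal_point_exists[of f 1 0] by auto
  then have le: "inner (y - z) (- z) \<le> D z - D y" for y
    by (auto simp: subdifferential_def f_def algebra_simps dest: spec[of _ y])
  \<comment> \<open>the points \<open>z + h\<close> and \<open>z - h\<close> give the two inequalities\<close>
  have "D h = inner h z" for h
    using le[of "z + h"] le[of "z - h"] by (simp add: D.add D.diff)
  then show ?thesis by blast
qed

lemma GDERIV_gradient:
  fixes f :: "'a::{real_inner, complete_space} \<Rightarrow> ereal"
  assumes "frechet_differentiable f"
  shows "GDERIV (\<lambda>y. real_of_ereal (f y)) x :> gradient f x"
proof -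
  obtain D where D: "((\<lambda>y. real_of_ereal (f y)) has_derivative D) (at x)"
    using assms unfolding frechet_differentiable_def differentiable_def by blast
  then obtain g where "D = (\<lambda>h. inner h g)"
    using Riesz_representation has_derivative_bounded_linear by blast
  then have "GDERIV (\<lambda>y. real_of_ereal (f y)) x :> g" using D by (simp add: gderiv_def)
  then show ?thesis using gradient_eqI by metis
qed

lemma GDERIV_line:
  assumes "GDERIV F (x + t *\<^sub>R d) :> g"
  shows "((\<lambda>t. F (x + t *\<^sub>R d)) has_real_derivative inner d g) (at t)"
proof -
  have "((\<lambda>t. x + t *\<^sub>R d) has_derivative (\<lambda>h. h *\<^sub>R d)) (at t)"
    by (auto intro!: derivative_eq_intros)
  from has_derivative_compose[OF this, of F "\<lambda>h. inner h g"] assms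
  have "((\<lambda>t. F (x + t *\<^sub>R d)) has_derivative (\<lambda>h. inner (h *\<^sub>R d) g)) (at t)"
    by (simp add: gderiv_def)
  moreover have "(\<lambda>h. inner (h *\<^sub>R d) g) = (*) (inner d g)" by (auto simp: mult.commute)
  ultimately show ?thesis by (simp add: has_field_derivative_def)
qed

lemma GDERIV_half_norm_sq:
  assumes "\<mu> \<noteq> 0"
  shows "GDERIV (\<lambda>x. (norm x)\<^sup>2 / (2 * \<mu>)) x :> (1 / \<mu>) *\<^sub>R x"
  unfolding gderiv_def power2_norm_eq_inner
  by (rule derivative_eq_intros refl)+ (use assms in \<open>auto simp: fun_eq_iff inner_commute divide_simps\<close>)

lemma subdifferential_eq_gradient:
  fixes f :: "'a::{real_inner, complete_space} \<Rightarrow> ereal"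
  assumes diff: "frechet_differentiable f" and conv: "convex_fun f"
  shows "subdifferential f x = {gradient f x}"
proof -
  define F where "F = (\<lambda>y. real_of_ereal (f y))"
  have F: "f y = ereal (F y)" for y
    using diff by (auto simp: frechet_differentiable_def F_def ereal_real)
  have G: "GDERIV F x :> gradient f x" using GDERIV_gradient[OF diff] by (simp add: F_def)
  have line: "((\<lambda>t. F (x + t *\<^sub>R d)) has_real_derivative inner d (gradient f x)) (at 0)" for d
    by (rule GDERIV_line) (simp add: G)
  have "u = gradient f x" if u: "\<And>y. F x + inner (y - x) u \<le> F y" for u
  proof -
    have "inner d (gradient f x) - inner d u = 0" for d
    proof (rule DERIV_local_min[OF _ zero_less_one])
      show "((\<lambda>t. F (x + t *\<^sub>R d) - t * inner d u) has_real_derivative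
          inner d (gradient f x) - inner d u) (at 0)"
        by (auto intro!: derivative_eq_intros line)
      show "\<forall>t. \<bar>0 - t\<bar> < 1 \<longrightarrow>
          F (x + 0 *\<^sub>R d) - 0 * inner d u \<le> F (x + t *\<^sub>R d) - t * inner d u"
        using u[of "x + _ *\<^sub>R d"] by (simp add: algebra_simps)
    qed
    from this[of "gradient f x - u"] show ?thesis by (simp flip: inner_diff_right)
  qed
  moreover have "F x + inner (y - x) (gradient f x) \<le> F y" for y
  proof -
    have ev: "eventually (\<lambda>t. (F (x + t *\<^sub>R (y - x)) - F x) / t \<le> F y - F x) (at_right 0)"
    proof -
      have "(F (x + t *\<^sub>R (y - x)) - F x) / t \<le> F y - F x" if "0 < t" "t < 1" for t
      proof -
        have "(1 - t) *\<^sub>R x + t *\<^sub>R y = x + t *\<^sub>R (y - x)" by (simp add: algebra_simps)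
        then have "F (x + t *\<^sub>R (y - x)) \<le> (1 - t) * F x + t * F y"
          using convex_fun_combination_le[OF conv F[of x] F[of y], of t] that F by simp
        then show ?thesis using that by (simp add: field_simps)
      qed
      then show ?thesis by (auto simp: eventually_at_right_field intro!: exI[of _ 1])
    qed
    have "((\<lambda>t. (F (x + t *\<^sub>R (y - x)) - F x) / t) \<longlongrightarrow> inner (y - x) (gradient f x)) (at_right 0)"
      using line[of "y - x"] unfolding DERIV_def
      by (simp add: filterlim_at_split)
    from tendsto_upperbound[OF this ev] show ?thesis by simp
  qed
  ultimately show ?thesis unfolding subdifferential_def F by auto
qed

text \<open>The constant \<open>L\<close> may have any sign. Applied to \<open>- F\<close> with \<open>L = 0\<close>, the lemma says that a function
  with monotone gradient lies above its tangents.\<close>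

lemma GDERIV_quadratic_upper_bound:
  assumes G: "\<And>x. GDERIV F x :> g x"
    and L: "\<And>x y. inner (x - y) (g x - g y) \<le> L * (norm (x - y))\<^sup>2"
  shows "F y \<le> F x + inner (y - x) (g x) + L / 2 * (norm (y - x))\<^sup>2"
proof -
  define d where "d = y - x"
  define \<theta> where "\<theta> = (\<lambda>t. F (x + t *\<^sub>R d) - t * inner d (g x) - L / 2 * t\<^sup>2 * (norm d)\<^sup>2)"
  have "\<theta> 1 \<le> \<theta> 0"
  proof (rule DERIV_nonpos_imp_nonincreasing[of 0 1 \<theta>])
    fix t :: real assume t: "0 \<le> t" "t \<le> 1"
    have "(\<theta> has_real_derivative
        inner d (g (x + t *\<^sub>R d)) - inner d (g x) - L * t * (norm d)\<^sup>2) (at t)"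
      unfolding \<theta>_def by (auto intro!: derivative_eq_intros GDERIV_line G)
    moreover have "inner d (g (x + t *\<^sub>R d)) - inner d (g x) - L * t * (norm d)\<^sup>2 \<le> 0"
    proof (cases "t = 0")
      case False
      have "t * inner d (g (x + t *\<^sub>R d) - g x) \<le> L * (t\<^sup>2 * (norm d)\<^sup>2)"
        using L[of "x + t *\<^sub>R d" x] by (simp add: power_mult_distrib)
      then have "t * (inner d (g (x + t *\<^sub>R d) - g x) - L * t * (norm d)\<^sup>2) \<le> 0"
        by (simp add: algebra_simps power2_eq_square)
      then show ?thesis using t False by (simp add: mult_le_0_iff inner_diff_right)
    qed simp
    ultimately show "\<exists>y. (\<theta> has_real_derivative y) (at t) \<and> y \<le> 0" by blast
  qed simp
  then show ?thesis by (simp add: \<theta>_def d_def)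
qed

text \<open>The hypotheses describe a convex function whose gradient is one-sidedly Lipschitz; Lipschitz
  continuity of the gradient is not assumed.\<close>

lemma Baillon_Haddad:
  assumes G: "\<And>x. GDERIV F x :> g x" and "L > 0"
    and mono: "\<And>x y. 0 \<le> inner (x - y) (g x - g y)"
    and L: "\<And>x y. inner (x - y) (g x - g y) \<le> L * (norm (x - y))\<^sup>2"
  shows "(norm (g x - g y))\<^sup>2 \<le> L * inner (x - y) (g x - g y)"
proof -
  have below: "F x + inner (y - x) (g x) \<le> F y" for x y
    using GDERIV_quadratic_upper_bound[of "\<lambda>x. - F x" "\<lambda>x. - g x" 0 y x] GDERIV_minus[OF G] mono
    by (simp add: inner_diff_right)
  have gap: "F x + inner (y - x) (g x) + (norm (g y - g x))\<^sup>2 / (2 * L) \<le> F y" for x y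
  proof -
    define d where "d = g y - g x"
    \<comment> \<open>a gradient step of size \<open>1 / L\<close> from \<open>y\<close> for the function \<open>F - \<langle>., g x\<rangle>\<close>, minimal at \<open>x\<close>\<close>
    define z where "z = y - (1 / L) *\<^sub>R d"
    have "F x + inner (z - x) (g x) \<le> F y + inner (z - y) (g y) + L / 2 * (norm (z - y))\<^sup>2"
      using below[of x z] GDERIV_quadratic_upper_bound[OF G L, of z y] by linarith
    moreover have "inner (z - x) (g x) = inner (y - x) (g x) - inner d (g x) / L"
      by (simp add: z_def inner_diff_left)
    moreover have "inner (z - y) (g y) = - inner d (g y) / L"
      by (simp add: z_def)
    moreover have "L / 2 * (norm (z - y))\<^sup>2 = (norm d)\<^sup>2 / (2 * L)"
      using \<open>L > 0\<close> by (simp add: z_def power_divide power2_eq_square)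
    moreover have "inner d (g y) / L - inner d (g x) / L = (norm d)\<^sup>2 / L"
      by (simp add: d_def power2_norm_eq_inner inner_diff_right diff_divide_distrib)
    moreover have "(norm d)\<^sup>2 / L = 2 * ((norm d)\<^sup>2 / (2 * L))" by simp
    ultimately have "F x + inner (y - x) (g x) + (norm d)\<^sup>2 / (2 * L) \<le> F y"
      by linarith
    then show ?thesis by (simp add: d_def)
  qed
  have "(norm (g x - g y))\<^sup>2 / L \<le> inner (x - y) (g x - g y)"
    using gap[of x y] gap[of y x]
    by (simp add: norm_minus_commute inner_diff_left inner_diff_right)
  then show ?thesis using \<open>L > 0\<close> by (simp add: field_simps)
qed

lemma GDERIV_monotone_imp_lipschitz:
  assumes G: "\<And>x. GDERIV F x :> g x" and "L \<ge> 0"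
    and mono: "\<And>x y. 0 \<le> inner (x - y) (g x - g y)"
    and L: "\<And>x y. inner (x - y) (g x - g y) \<le> L * (norm (x - y))\<^sup>2"
  shows "L-lipschitz_on UNIV g"
proof (rule lipschitz_onI)
  fix x y
  \<comment> \<open>the Baillon-Haddad inequality needs a positive constant\<close>
  define M where "M = (if L = 0 then 1 else L)"
  have M: "M > 0" "L \<le> M" "M * L = L\<^sup>2" using \<open>L \<ge> 0\<close> by (auto simp: M_def power2_eq_square)
  have "(norm (g x - g y))\<^sup>2 \<le> M * inner (x - y) (g x - g y)"
  proof (rule Baillon_Haddad[OF G M(1) mono])
    show "inner (x - y) (g x - g y) \<le> M * (norm (x - y))\<^sup>2" for x y
      using L[of x y] mult_right_mono[OF M(2), of "(norm (x - y))\<^sup>2"] by simp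
  qed
  also have "\<dots> \<le> M * (L * (norm (x - y))\<^sup>2)" using L M(1) by (intro mult_left_mono) auto
  also have "\<dots> = (L * norm (x - y))\<^sup>2" using M(3) by (simp add: power_mult_distrib flip: mult.assoc)
  finally show "dist (g x) (g y) \<le> L * dist x y"
    using \<open>L \<ge> 0\<close> by (simp add: dist_norm)
qed fact

text \<open>The error of the linear approximation is squeezed between \<open>0\<close> and
  \<open>\<langle>y - x, Q y - Q x\<rangle> \<le> K |y - x|\<^sup>2\<close>.\<close>

lemma GDERIV_of_lipschitz_subgradient:
  fixes H :: "'a::real_inner \<Rightarrow> real"
  assumes sub: "\<And>x y. H x + inner (y - x) (Q x) \<le> H y"
    and lip: "K-lipschitz_on UNIV Q"
  shows "GDERIV H x :> Q x"
  unfolding gderiv_def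
proof (rule has_derivativeI_sandwich[OF zero_less_one])
  show "bounded_linear (\<lambda>h. inner h (Q x))" by (rule bounded_linear_inner_left)
  show "((\<lambda>y. K * norm (y - x)) \<longlongrightarrow> 0) (at x)"
    by (rule tendsto_eq_intros | simp)+
  fix y assume "y \<noteq> x"
  have "0 \<le> H y - H x - inner (y - x) (Q x)" using sub[of x y] by simp
  moreover have "H y - H x - inner (y - x) (Q x) \<le> inner (y - x) (Q y - Q x)"
    using sub[of y x] by (simp add: inner_diff_left inner_diff_right)
  moreover have "inner (y - x) (Q y - Q x) \<le> norm (y - x) * norm (Q y - Q x)"
    by (rule norm_cauchy_schwarz)
  moreover have "norm (y - x) * norm (Q y - Q x) \<le> norm (y - x) * (K * norm (y - x))"
    using lipschitz_onD[OF lip, of y x] by (intro mult_left_mono) (auto simp: dist_norm)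
  ultimately have "norm (H y - H x - inner (y - x) (Q x)) \<le> K * norm (y - x) * norm (y - x)"
    by (simp add: mult.commute mult.left_commute)
  then show "norm (H y - H x - inner (y - x) (Q x)) / norm (y - x) \<le> K * norm (y - x)"
    using \<open>y \<noteq> x\<close> by (simp add: divide_le_eq)
qed

section \<open>Resolvents of subdifferentials\<close>

lemma subdifferential_finite:
  assumes "proper_fun f" "u \<in> subdifferential f x"
  shows "\<bar>f x\<bar> \<noteq> \<infinity>"
proof -
  obtain y where y: "f y \<noteq> \<infinity>" using assms(1) by (auto simp: proper_fun_def)
  have "f x + ereal (inner (y - x) u) \<le> f y" using assms(2) by (simp add: subdifferential_def)
  then have "f x \<noteq> \<infinity>" using y by auto
  then show ?thesis using assms(1) by (auto simp: proper_fun_def)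
qed

lemma subdifferential_real_le:
  assumes "proper_fun f" "u \<in> subdifferential f x" "f x = ereal a" "f y = ereal b"
  shows "a + inner (y - x) u \<le> b"
  using assms(2)[unfolded subdifferential_def, simplified, rule_format, of y] assms(3,4) by simp

lemma subdifferential_monotone:
  assumes f: "proper_fun f" and u: "u \<in> subdifferential f x" and v: "v \<in> subdifferential f y"
  shows "0 \<le> inner (x - y) (u - v)"
proof -
  obtain a b where "f x = ereal a" "f y = ereal b"
    using subdifferential_finite[OF f u] subdifferential_finite[OF f v] by fastforce
  then show ?thesis
    using subdifferential_real_le[OF f u, of a y b] subdifferential_real_le[OF f v, of b x a]
    by (simp add: inner_diff_left inner_diff_right)
qed

text \<open>The condition \<open>u - x/\<mu> \<in> \<partial>f x\<close> says that \<open>x\<close> is the value at \<open>u\<close> of the resolvent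
  \<open>(\<partial>f + \<mu>\<^sup>-\<^sup>1 Id)\<^sup>-\<^sup>1\<close>.\<close>

lemma resolvent_cocoercive:
  assumes f: "proper_fun f"
    and x: "u - (1 / \<mu>) *\<^sub>R x \<in> subdifferential f x"
    and y: "v - (1 / \<mu>) *\<^sub>R y \<in> subdifferential f y"
  shows "(norm (x - y))\<^sup>2 / \<mu> \<le> inner (x - y) (u - v)"
  using subdifferential_monotone[OF f x y]
  by (simp add: power2_norm_eq_inner inner_diff_left inner_diff_right diff_divide_distrib add_divide_distrib)

lemma resolvent_unique:
  assumes "proper_fun f" "\<mu> > 0"
    and "u - (1 / \<mu>) *\<^sub>R x \<in> subdifferential f x" "u - (1 / \<mu>) *\<^sub>R y \<in> subdifferential f y"
  shows "x = y"
  using resolvent_cocoercive[OF assms(1,3,4)] assms(2) by (simp add: divide_le_0_iff)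

lemma resolvent_exists:
  fixes f :: "'a::{real_inner, complete_space} \<Rightarrow> ereal"
  assumes "proper_fun f" "lsc_fun f" "convex_fun f" and "\<mu> > 0"
  shows "\<exists>x. u - (1 / \<mu>) *\<^sub>R x \<in> subdifferential f x"
  using proximal_point_exists[OF assms, of "\<mu> *\<^sub>R u"] assms(4) by (auto simp: algebra_simps)

lemma resolvent_strongly_monotone:
  fixes f :: "'a::{real_inner, complete_space} \<Rightarrow> ereal"
  assumes f: "proper_fun f" "convex_fun f" "frechet_differentiable f"
    and lip: "L-lipschitz_on UNIV (gradient f)" and \<mu>: "\<mu> > 0"
    and x: "u - (1 / \<mu>) *\<^sub>R x \<in> subdifferential f x"
    and y: "v - (1 / \<mu>) *\<^sub>R y \<in> subdifferential f y"
  shows "(norm (u - v))\<^sup>2 / (L + 1 / \<mu>) \<le> inner (x - y) (u - v)"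
proof -
  \<comment> \<open>the gradient of \<open>f + |.|\<^sup>2/(2\<mu>)\<close>; the resolvent is its inverse\<close>
  define h where "h = (\<lambda>x. gradient f x + (1 / \<mu>) *\<^sub>R x)"
  have L: "L \<ge> 0" by (rule lipschitz_on_nonneg[OF lip])
  have M: "L + 1 / \<mu> > 0" using L \<mu> by (simp add: add_nonneg_pos)
  have split: "inner (x - y) (h x - h y)
      = inner (x - y) (gradient f x - gradient f y) + (norm (x - y))\<^sup>2 / \<mu>" for x y
    by (simp add: h_def power2_norm_eq_inner inner_diff_left inner_diff_right inner_add_right
        diff_divide_distrib)
  have bounds: "0 \<le> inner (x - y) (gradient f x - gradient f y)"
    "inner (x - y) (gradient f x - gradient f y) \<le> L * (norm (x - y))\<^sup>2" for x y
  proof -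
    show "0 \<le> inner (x - y) (gradient f x - gradient f y)"
      using subdifferential_monotone[OF f(1)] subdifferential_eq_gradient[OF f(3,2)] by blast
    have "inner (x - y) (gradient f x - gradient f y)
        \<le> norm (x - y) * norm (gradient f x - gradient f y)" by (rule norm_cauchy_schwarz)
    also have "\<dots> \<le> norm (x - y) * (L * norm (x - y))"
      using lipschitz_onD[OF lip, of x y] by (intro mult_left_mono) (auto simp: dist_norm)
    finally show "inner (x - y) (gradient f x - gradient f y) \<le> L * (norm (x - y))\<^sup>2"
      by (simp add: power2_eq_square mult_ac)
  qed
  have "(norm (h x - h y))\<^sup>2 \<le> (L + 1 / \<mu>) * inner (x - y) (h x - h y)"
  proof (rule Baillon_Haddad[OF _ M])
    show "GDERIV (\<lambda>x. real_of_ereal (f x) + (norm x)\<^sup>2 / (2 * \<mu>)) x :> h x" for x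
      unfolding h_def using \<mu> by (intro GDERIV_add GDERIV_gradient f GDERIV_half_norm_sq) simp
    show "0 \<le> inner (x - y) (h x - h y)" for x y
      using bounds(1)[of x y] \<mu> by (simp add: split)
    show "inner (x - y) (h x - h y) \<le> (L + 1 / \<mu>) * (norm (x - y))\<^sup>2" for x y
      unfolding split ring_distribs using bounds(2)[of x y] by simp
  qed
  moreover have "h x = u" "h y = v"
    using x y subdifferential_eq_gradient[OF f(3,2)] by (auto simp: h_def algebra_simps)
  ultimately show ?thesis using M by (simp add: divide_le_eq mult.commute)
qed

section \<open>Weighted averages of resolvents\<close>

lemma norm_sum_sq_le:
  fixes z :: "'i \<Rightarrow> 'a::real_inner"
  assumes "finite I" "\<And>i. i \<in> I \<Longrightarrow> w i > 0" "(\<Sum>i\<in>I. w i) = 1"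
  shows "(norm (\<Sum>i\<in>I. w i *\<^sub>R z i))\<^sup>2 \<le> (\<Sum>i\<in>I. w i * (norm (z i))\<^sup>2)"
proof -
  define m where "m = (\<Sum>i\<in>I. w i *\<^sub>R z i)"
  have "0 \<le> (\<Sum>i\<in>I. w i * (norm (z i - m))\<^sup>2)"
    using assms(2) by (intro sum_nonneg) (simp add: less_imp_le)
  also have "\<dots> = (\<Sum>i\<in>I. w i * (norm (z i))\<^sup>2 + w i * (norm m)\<^sup>2 - 2 * inner (w i *\<^sub>R z i) m)"
    by (intro sum.cong refl)
      (simp add: power2_norm_eq_inner inner_diff_left inner_diff_right inner_commute algebra_simps)
  also have "\<dots> = (\<Sum>i\<in>I. w i * (norm (z i))\<^sup>2) + (\<Sum>i\<in>I. w i) * (norm m)\<^sup>2 - 2 * inner m m"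
    by (simp add: sum.distrib sum_subtractf m_def inner_sum_left sum_distrib_right
        flip: sum_distrib_left)
  finally show ?thesis using assms(3) by (simp add: power2_norm_eq_inner m_def)
qed

text \<open>The indices outside \<open>I0\<close> contribute a nonnegative amount to the second bound, since each \<open>P i\<close>
  is monotone.\<close>

lemma average_bounds:
  fixes P :: "'i \<Rightarrow> 'a::real_inner \<Rightarrow> 'a"
  assumes "finite I" "\<mu> > 0" and w: "\<And>i. i \<in> I \<Longrightarrow> w i > 0" "(\<Sum>i\<in>I. w i) = 1"
    and coco: "\<And>i. i \<in> I \<Longrightarrow> (norm (P i u - P i v))\<^sup>2 / \<mu> \<le> inner (P i u - P i v) (u - v)"
    and I0: "I0 \<subseteq> I"
    and strong: "\<And>i. i \<in> I0 \<Longrightarrow> k i * (norm (u - v))\<^sup>2 \<le> inner (P i u - P i v) (u - v)"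
    and T: "T = (\<lambda>u. \<Sum>i\<in>I. w i *\<^sub>R P i u)"
  shows "(norm (T u - T v))\<^sup>2 / \<mu> \<le> inner (T u - T v) (u - v)"
    and "(\<Sum>i\<in>I0. w i * k i) * (norm (u - v))\<^sup>2 \<le> inner (T u - T v) (u - v)"
proof -
  let ?z = "\<lambda>i. P i u - P i v"
  have T_diff: "T u - T v = (\<Sum>i\<in>I. w i *\<^sub>R ?z i)"
    by (simp add: T sum_subtractf scaleR_diff_right)
  have inner_T: "inner (T u - T v) (u - v) = (\<Sum>i\<in>I. w i * inner (?z i) (u - v))"
    unfolding T_diff by (simp add: inner_sum_left)
  have "(norm (T u - T v))\<^sup>2 / \<mu> \<le> (\<Sum>i\<in>I. w i * (norm (?z i))\<^sup>2) / \<mu>"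
    unfolding T_diff using norm_sum_sq_le[of I w ?z] assms by (intro divide_right_mono) auto
  also have "\<dots> = (\<Sum>i\<in>I. w i * ((norm (?z i))\<^sup>2 / \<mu>))"
    by (simp add: sum_divide_distrib)
  also have "\<dots> \<le> (\<Sum>i\<in>I. w i * inner (?z i) (u - v))"
    using w(1) coco by (intro sum_mono mult_left_mono) (auto simp: less_imp_le)
  finally show "(norm (T u - T v))\<^sup>2 / \<mu> \<le> inner (T u - T v) (u - v)"
    by (simp add: inner_T)
  have "(\<Sum>i\<in>I0. w i * k i) * (norm (u - v))\<^sup>2 = (\<Sum>i\<in>I0. w i * (k i * (norm (u - v))\<^sup>2))"
    by (simp add: sum_distrib_right mult.assoc)
  also have "\<dots> \<le> (\<Sum>i\<in>I0. w i * inner (?z i) (u - v))"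
    using w(1) I0 strong by (intro sum_mono mult_left_mono) (auto simp: less_imp_le subset_iff)
  also have "\<dots> \<le> (\<Sum>i\<in>I. w i * inner (?z i) (u - v))"
  proof (rule sum_mono2[OF \<open>finite I\<close> I0])
    fix i assume "i \<in> I - I0"
    then have "i \<in> I" by simp
    have "0 \<le> (norm (?z i))\<^sup>2 / \<mu>" using \<open>\<mu> > 0\<close> by simp
    also have "\<dots> \<le> inner (?z i) (u - v)" by (rule coco) fact
    finally show "0 \<le> w i * inner (?z i) (u - v)" using w(1)[OF \<open>i \<in> I\<close>] by simp
  qed
  finally show "(\<Sum>i\<in>I0. w i * k i) * (norm (u - v))\<^sup>2 \<le> inner (T u - T v) (u - v)"
    by (simp add: inner_T)
qed

text \<open>Solving \<open>T u = x\<close> amounts to finding a fixed point of \<open>u \<mapsto> u - (T u - x)/\<mu>\<close>, whose squared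
  Lipschitz constant is at most \<open>1 - c/\<mu>\<close>.\<close>

lemma strongly_monotone_cocoercive_bij:
  fixes T :: "'a::{real_inner, complete_space} \<Rightarrow> 'a"
  assumes "c > 0" "\<mu> > 0"
    and strong: "\<And>u v. c * (norm (u - v))\<^sup>2 \<le> inner (T u - T v) (u - v)"
    and coco: "\<And>u v. (norm (T u - T v))\<^sup>2 / \<mu> \<le> inner (T u - T v) (u - v)"
  shows "bij T"
proof -
  have "\<exists>!u. T u = x" for x
  proof -
    define q where "q = 1 - c / \<mu>"
    define s where "s = 1 / \<mu>"
    define G where "G = (\<lambda>u. u - s *\<^sub>R (T u - x))"
    have step: "(norm (G u - G v))\<^sup>2 \<le> q * (norm (u - v))\<^sup>2" for u v
    proof -
      have "G u - G v = (u - v) - s *\<^sub>R (T u - T v)" by (simp add: G_def algebra_simps)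
      then have "(norm (G u - G v))\<^sup>2
          = (norm (u - v))\<^sup>2 - 2 * s * inner (T u - T v) (u - v) + s\<^sup>2 * (norm (T u - T v))\<^sup>2"
        unfolding power2_norm_eq_inner
        by (simp only: inner_diff_left[of "u - v" "s *\<^sub>R (T u - T v)"]
            inner_diff_right[of _ "u - v" "s *\<^sub>R (T u - T v)"])
          (simp add: inner_commute power2_eq_square algebra_simps)
      moreover have "s\<^sup>2 * (norm (T u - T v))\<^sup>2 \<le> s * inner (T u - T v) (u - v)"
        using mult_left_mono[OF coco[of u v], of s] \<open>\<mu> > 0\<close>
        by (simp add: s_def power2_eq_square mult_ac)
      moreover have "s * (c * (norm (u - v))\<^sup>2) \<le> s * inner (T u - T v) (u - v)"
        using strong[of u v] \<open>\<mu> > 0\<close> by (intro mult_left_mono) (auto simp: s_def)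
      moreover have "q * (norm (u - v))\<^sup>2 = (norm (u - v))\<^sup>2 - s * (c * (norm (u - v))\<^sup>2)"
        by (simp add: q_def s_def algebra_simps)
      ultimately show ?thesis by linarith
    qed
    \<comment> \<open>\<open>q\<close> can only be negative in the zero space, where the hypotheses do not force \<open>c \<le> \<mu>\<close>\<close>
    define r where "r = sqrt (max 0 q)"
    have "\<exists>!u. G u = u"
    proof (rule banach_fix_type)
      show "0 \<le> r" "r < 1" using assms(1,2) by (auto simp: r_def q_def real_sqrt_lt_1_iff)
      have "(norm (G u - G v))\<^sup>2 \<le> (r * norm (u - v))\<^sup>2" for u v
      proof -
        have "q * (norm (u - v))\<^sup>2 \<le> max 0 q * (norm (u - v))\<^sup>2"
          by (intro mult_right_mono) auto
        then show ?thesis using step[of u v] by (simp add: r_def power_mult_distrib)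
      qed
      then show "\<forall>u v. dist (G u) (G v) \<le> r * dist u v"
        using \<open>0 \<le> r\<close> by (auto simp: dist_norm intro!: power2_le_imp_le)
    qed
    moreover have "G u = u \<longleftrightarrow> T u = x" for u
      using \<open>\<mu> > 0\<close> by (simp add: G_def s_def)
    ultimately show ?thesis by simp
  qed
  then show ?thesis by (auto simp: bij_iff)
qed

lemma sum_singleton_sets:
  fixes g :: "'i \<Rightarrow> 'b::comm_monoid_add"
  shows "finite I \<Longrightarrow> (\<Sum>i\<in>I. {g i}) = {\<Sum>i\<in>I. g i}"
  by (induction I rule: finite_induct) (auto simp: set_plus_def set_zero)

lemma resolvent_set:
  assumes "proper_fun f" "\<mu> > 0" and x: "u - (1 / \<mu>) *\<^sub>R x \<in> subdifferential f x"
  shows "sv_inverse (sv_add (subdifferential f) (sv_scale (inverse \<mu>) sv_id)) u = {x}"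
proof -
  have "sv_inverse (sv_add (subdifferential f) (sv_scale (inverse \<mu>) sv_id)) u
      = {y. u - (1 / \<mu>) *\<^sub>R y \<in> subdifferential f y}"
    by (force simp: sv_inverse_def sv_add_def sv_scale_def sv_id_def set_plus_def inverse_eq_divide)
  then show ?thesis using x resolvent_unique[OF assms(1,2)] by blast
qed

text \<open>Here \<open>P i\<close> are the resolvents and \<open>Q\<close> is the inverse of their weighted average.\<close>

lemma resolvent_average_eq:
  assumes "finite I" "\<mu> > 0" and "\<And>i. i \<in> I \<Longrightarrow> proper_fun (f i)"
    and P: "\<And>i u. i \<in> I \<Longrightarrow> u - (1 / \<mu>) *\<^sub>R P i u \<in> subdifferential (f i) (P i u)"
    and Q: "\<And>x u. (\<Sum>i\<in>I. w i *\<^sub>R P i u) = x \<longleftrightarrow> u = Q x"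
  shows "resolvent_average \<mu> I (\<lambda>i. subdifferential (f i)) w x = {Q x - (1 / \<mu>) *\<^sub>R x}"
proof -
  have "(\<Sum>i\<in>I. sv_scale (w i) (sv_inverse (sv_add (subdifferential (f i)) (sv_scale (inverse \<mu>) sv_id))) u)
      = (\<Sum>i\<in>I. {w i *\<^sub>R P i u})" for u
    unfolding sv_scale_def[of "w _"]
    by (intro sum.cong refl) (simp add: resolvent_set[OF assms(3) \<open>\<mu> > 0\<close> P])
  then have "sv_inverse (\<lambda>u. \<Sum>i\<in>I. sv_scale (w i)
      (sv_inverse (sv_add (subdifferential (f i)) (sv_scale (inverse \<mu>) sv_id))) u) x = {Q x}"
    by (simp add: sv_inverse_def sum_singleton_sets[OF \<open>finite I\<close>] Q eq_commute[of x])
  then show ?thesis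
    unfolding resolvent_average_def sv_add_def[of "sv_inverse _"]
    by (simp add: sv_scale_def sv_id_def set_plus_def inverse_eq_divide)
qed

section \<open>Proximal averages and the differentiability theorem\<close>

text \<open>The subgradient inequality at \<open>p\<close> for \<open>\<mu> f + |.|\<^sup>2/2\<close>, whose subdifferential there contains
  \<open>\<mu> u\<close>.\<close>

lemma regularized_supporting_affine:
  assumes f: "proper_fun f" and "\<mu> > 0"
    and p: "u - (1 / \<mu>) *\<^sub>R p \<in> subdifferential f p" and a: "f p = ereal a" and b: "f z = ereal b"
  shows "\<mu> * a + (norm p)\<^sup>2 / 2 + \<mu> * inner (z - p) u \<le> \<mu> * b + (norm z)\<^sup>2 / 2"
proof -
  have "a + inner (z - p) u - inner (z - p) p / \<mu> \<le> b"
    using subdifferential_real_le[OF f p a b] by (simp add: inner_diff_right)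
  from mult_left_mono[OF this, of \<mu>]
  have "\<mu> * a + \<mu> * inner (z - p) u - inner (z - p) p \<le> \<mu> * b"
    using \<open>\<mu> > 0\<close> by (simp add: ring_distribs)
  moreover have "0 \<le> (norm (z - p))\<^sup>2" by simp
  then have "inner (z - p) p \<le> (norm z)\<^sup>2 / 2 - (norm p)\<^sup>2 / 2"
    by (simp add: power2_norm_eq_inner inner_diff_left inner_diff_right inner_commute)
  ultimately show ?thesis by linarith
qed

text \<open>The decomposition \<open>x = \<Sum>\<^sub>i w\<^sub>i p\<^sub>i\<close> whose parts are the resolvent values at one common \<open>u\<close> attains
  the infimum in the proximal average: by the supporting affine functions with common slope \<open>u\<close>,
  another decomposition changes the lower bounds by a total of zero.\<close>

lemma proximal_average_eq:
  fixes f :: "'i \<Rightarrow> 'a::real_inner \<Rightarrow> ereal"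
  assumes "finite I" "\<mu> > 0" and w: "\<And>i. i \<in> I \<Longrightarrow> w i > 0"
    and f: "\<And>i. i \<in> I \<Longrightarrow> proper_fun (f i)"
    and p: "\<And>i. i \<in> I \<Longrightarrow> u - (1 / \<mu>) *\<^sub>R p i \<in> subdifferential (f i) (p i)"
    and F: "\<And>i. i \<in> I \<Longrightarrow> f i (p i) = ereal (F i)"
    and x: "(\<Sum>i\<in>I. w i *\<^sub>R p i) = x"
  shows "proximal_average \<mu> I f w x
    = ereal ((\<Sum>i\<in>I. w i * (F i + (norm (p i))\<^sup>2 / (2 * \<mu>))) - (norm x)\<^sup>2 / (2 * \<mu>))"
proof -
  define \<tau> where "\<tau> = (\<lambda>i z. ereal (w i) *
    (ereal \<mu> * f i (z /\<^sub>R w i) + ereal (1/2 * (norm (z /\<^sub>R w i))\<^sup>2)))"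
  define C where "C = (\<Sum>i\<in>I. w i * (\<mu> * F i + (norm (p i))\<^sup>2 / 2))"
  have lower: "ereal (w i * (\<mu> * F i + (norm (p i))\<^sup>2 / 2) + \<mu> * inner (z - w i *\<^sub>R p i) u) \<le> \<tau> i z"
    if i: "i \<in> I" for i z
  proof (cases "f i (z /\<^sub>R w i) = \<infinity>")
    case True
    then show ?thesis using w[OF i] \<open>\<mu> > 0\<close> by (simp add: \<tau>_def)
  next
    case False
    then obtain b where b: "f i (z /\<^sub>R w i) = ereal b" using f[OF i] proper_funE by metis
    have "z - w i *\<^sub>R p i = w i *\<^sub>R (z /\<^sub>R w i - p i)" using w[OF i] by (simp add: algebra_simps)
    then have "inner (z - w i *\<^sub>R p i) u = w i * inner (z /\<^sub>R w i - p i) u"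
      by (metis inner_scaleR_left)
    then have "w i * (\<mu> * F i + (norm (p i))\<^sup>2 / 2) + \<mu> * inner (z - w i *\<^sub>R p i) u
        = w i * (\<mu> * F i + (norm (p i))\<^sup>2 / 2 + \<mu> * inner (z /\<^sub>R w i - p i) u)"
      by (simp add: ring_distribs mult.left_commute)
    also have "\<dots> \<le> w i * (\<mu> * b + (norm (z /\<^sub>R w i))\<^sup>2 / 2)"
      using regularized_supporting_affine[OF f[OF i] \<open>\<mu> > 0\<close> p[OF i] F[OF i] b] w[OF i]
      by (intro mult_left_mono) auto
    finally show ?thesis by (simp add: \<tau>_def b)
  qed
  have "(INF y\<in>{y. (\<Sum>i\<in>I. y i) = x}. \<Sum>i\<in>I. \<tau> i (y i)) = ereal C"
  proof (rule antisym)
    have "(\<Sum>i\<in>I. \<tau> i (w i *\<^sub>R p i)) = (\<Sum>i\<in>I. ereal (w i * (\<mu> * F i + (norm (p i))\<^sup>2 / 2)))"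
      using w by (intro sum.cong refl) (auto simp: \<tau>_def F order_less_imp_not_eq2)
    then have "(\<Sum>i\<in>I. \<tau> i (w i *\<^sub>R p i)) = ereal C" by (simp add: C_def)
    then show "(INF y\<in>{y. (\<Sum>i\<in>I. y i) = x}. \<Sum>i\<in>I. \<tau> i (y i)) \<le> ereal C"
      using x by (intro INF_lower2[of "\<lambda>i. w i *\<^sub>R p i"]) auto
    show "ereal C \<le> (INF y\<in>{y. (\<Sum>i\<in>I. y i) = x}. \<Sum>i\<in>I. \<tau> i (y i))"
    proof (rule INF_greatest)
      fix y assume "y \<in> {y. (\<Sum>i\<in>I. y i) = x}"
      then have "(\<Sum>i\<in>I. inner (y i - w i *\<^sub>R p i) u) = 0"
        using x by (simp add: sum_subtractf flip: inner_sum_left)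
      then have "C = (\<Sum>i\<in>I. w i * (\<mu> * F i + (norm (p i))\<^sup>2 / 2) + \<mu> * inner (y i - w i *\<^sub>R p i) u)"
        by (simp add: C_def sum.distrib flip: sum_distrib_left)
      then have "ereal C = (\<Sum>i\<in>I. ereal (w i * (\<mu> * F i + (norm (p i))\<^sup>2 / 2)
          + \<mu> * inner (y i - w i *\<^sub>R p i) u))" by simp
      also have "\<dots> \<le> (\<Sum>i\<in>I. \<tau> i (y i))" by (intro sum_mono lower)
      finally show "ereal C \<le> (\<Sum>i\<in>I. \<tau> i (y i))" .
    qed
  qed
  then have "proximal_average \<mu> I f w x = ereal (1 / \<mu> * (- (1/2) * (norm x)\<^sup>2 + C))"
    by (simp add: proximal_average_def \<tau>_def)
  moreover have "C = \<mu> * (\<Sum>i\<in>I. w i * (F i + (norm (p i))\<^sup>2 / (2 * \<mu>)))"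
    unfolding C_def sum_distrib_left
    using \<open>\<mu> > 0\<close> by (intro sum.cong refl) (simp add: field_simps)
  ultimately show ?thesis using \<open>\<mu> > 0\<close> by (simp add: field_simps)
qed

lemma harmonic_const_eq:
  assumes "finite I" "\<mu> > 0" "I0 \<subseteq> I"
    and c: "0 < (\<Sum>i\<in>I0. w i / (L i + 1 / \<mu>))"
    and L: "\<And>i. i \<in> I0 \<Longrightarrow> e i = ereal (L i)" "\<And>i. i \<in> I0 \<Longrightarrow> L i \<ge> 0"
    and "\<And>i. i \<in> I - I0 \<Longrightarrow> e i = \<infinity>"
  shows "harmonic_const \<mu> I e w = ereal (1 / (\<Sum>i\<in>I0. w i / (L i + 1 / \<mu>)) - 1 / \<mu>)"
proof -
  have "(\<Sum>i\<in>I. ereal (w i) * inverse (e i + ereal (inverse \<mu>)))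
      = (\<Sum>i\<in>I0. ereal (w i) * inverse (e i + ereal (inverse \<mu>)))"
    using assms by (intro sum.mono_neutral_right) auto
  also have "\<dots> = (\<Sum>i\<in>I0. ereal (w i / (L i + 1 / \<mu>)))"
  proof (intro sum.cong refl)
    fix i assume i: "i \<in> I0"
    have "L i + inverse \<mu> > 0" using L(2)[OF i] \<open>\<mu> > 0\<close> by (simp add: add_nonneg_pos)
    then show "ereal (w i) * inverse (e i + ereal (inverse \<mu>)) = ereal (w i / (L i + 1 / \<mu>))"
      by (simp add: L(1)[OF i] divide_inverse)
  qed
  finally show ?thesis using c by (simp add: harmonic_const_def divide_inverse)
qed

theorem theorem3p25:
  fixes f :: "nat \<Rightarrow> 'a::{real_inner, complete_space} \<Rightarrow> ereal"
    and \<mu> :: real and n :: nat and w :: "nat \<Rightarrow> real"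
    and I0 :: "nat set" and \<epsilon> :: "nat \<Rightarrow> ereal"
  assumes "\<mu> > 0" and "n \<ge> 1"
    and "\<And>i. i \<in> {1..n} \<Longrightarrow> w i > 0" and "(\<Sum>i\<in>{1..n}. w i) = 1"
    and "\<And>i. i \<in> {1..n} \<Longrightarrow> proper_fun (f i)"
    and "\<And>i. i \<in> {1..n} \<Longrightarrow> lsc_fun (f i)"
    and "\<And>i. i \<in> {1..n} \<Longrightarrow> convex_fun (f i)"
    and "I0 \<noteq> {}" and "I0 \<subseteq> {1..n}"
    and "\<And>i. i \<in> I0 \<Longrightarrow> frechet_differentiable (f i)"
    and "\<And>i. i \<in> I0 \<Longrightarrow> lipschitz_with (\<epsilon> i) (gradient (f i))"
    and "\<And>i. i \<in> {1..n} - I0 \<Longrightarrow> \<epsilon> i = \<infinity>"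
  shows "frechet_differentiable (proximal_average \<mu> {1..n} f w) \<and>
    (\<forall>x. resolvent_average \<mu> {1..n} (\<lambda>i. subdifferential (f i)) w x
          = {gradient (proximal_average \<mu> {1..n} f w) x}) \<and>
    lipschitz_with (harmonic_const \<mu> {1..n} \<epsilon> w) (gradient (proximal_average \<mu> {1..n} f w))"
proof -
  define I where "I = {1..n}"
  note A = assms[folded I_def]
  have fin: "finite I" by (simp add: I_def)
  have "\<forall>i\<in>I0. \<exists>l. \<epsilon> i = ereal l \<and> l-lipschitz_on UNIV (gradient (f i))"
    using A(11) by (auto simp: lipschitz_with_def)
  then obtain L where L: "\<And>i. i \<in> I0 \<Longrightarrow> \<epsilon> i = ereal (L i)"
    "\<And>i. i \<in> I0 \<Longrightarrow> (L i)-lipschitz_on UNIV (gradient (f i))" by metis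
  have L0: "L i \<ge> 0" if "i \<in> I0" for i using lipschitz_on_nonneg[OF L(2)[OF that]] .
  have "\<forall>i\<in>I. \<forall>u. \<exists>x. u - (1 / \<mu>) *\<^sub>R x \<in> subdifferential (f i) x"
    using resolvent_exists A by blast
  then obtain P where P: "\<And>i u. i \<in> I \<Longrightarrow> u - (1 / \<mu>) *\<^sub>R P i u \<in> subdifferential (f i) (P i u)"
    by metis
  define T where "T = (\<lambda>u. \<Sum>i\<in>I. w i *\<^sub>R P i u)"
  define c where "c = (\<Sum>i\<in>I0. w i / (L i + 1 / \<mu>))"
  have w: "w i > 0" if "i \<in> I0" for i using that A(3,9) by blast
  have finI0: "finite I0" using A(9) fin finite_subset by blast
  have den: "L i + 1 / \<mu> > 0" if "i \<in> I0" for i using L0[OF that] A(1) by (simp add: add_nonneg_pos)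
  have c: "c > 0" unfolding c_def using w den A(8) finI0 by (intro sum_pos) auto
  have T_coco: "(norm (T u - T v))\<^sup>2 / \<mu> \<le> inner (T u - T v) (u - v)"
    and T_strong: "c * (norm (u - v))\<^sup>2 \<le> inner (T u - T v) (u - v)" for u v
  proof -
    have *: "(norm (P i u - P i v))\<^sup>2 / \<mu> \<le> inner (P i u - P i v) (u - v)" if "i \<in> I" for i
      using resolvent_cocoercive[OF A(5) P P] that by blast
    have **: "1 / (L i + 1 / \<mu>) * (norm (u - v))\<^sup>2 \<le> inner (P i u - P i v) (u - v)"
      if "i \<in> I0" for i
    proof -
      have "i \<in> I" using that A(9) by blast
      then show ?thesis
        using resolvent_strongly_monotone[OF A(5,7) A(10)[OF that] L(2)[OF that] A(1) P P, of u v]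
        by simp
    qed
    show "(norm (T u - T v))\<^sup>2 / \<mu> \<le> inner (T u - T v) (u - v)"
      using average_bounds(1)[OF fin A(1,3,4) * A(9) ** T_def] .
    show "c * (norm (u - v))\<^sup>2 \<le> inner (T u - T v) (u - v)"
      using average_bounds(2)[OF fin A(1,3,4) * A(9) ** T_def] by (simp add: c_def)
  qed
  have "bij T" by (rule strongly_monotone_cocoercive_bij[OF c A(1) T_strong T_coco])
  define Q where "Q = inv T"
  have TQ: "T (Q x) = x" for x unfolding Q_def using \<open>bij T\<close> by (simp add: bij_is_surj surj_f_inv_f)
  have QT: "T u = x \<longleftrightarrow> u = Q x" for u x
    unfolding Q_def using \<open>bij T\<close> bij_inv_eq_iff by metis
  have Q_coco: "(norm (x - y))\<^sup>2 / \<mu> \<le> inner (x - y) (Q x - Q y)"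
    and Q_strong: "c * (norm (Q x - Q y))\<^sup>2 \<le> inner (x - y) (Q x - Q y)" for x y
    using T_coco[of "Q x" "Q y"] T_strong[of "Q x" "Q y"] by (simp_all add: TQ)
  have Q_lip: "(1 / c)-lipschitz_on UNIV Q"
  proof (rule lipschitz_onI)
    fix x y
    have "c * (norm (Q x - Q y))\<^sup>2 \<le> norm (x - y) * norm (Q x - Q y)"
      using Q_strong[of x y] norm_cauchy_schwarz order_trans by blast
    then have "c * norm (Q x - Q y) \<le> norm (x - y)"
      by (cases "Q x = Q y") (auto simp: power2_eq_square simp flip: mult.assoc)
    then show "dist (Q x) (Q y) \<le> 1 / c * dist x y"
      using c by (simp add: dist_norm field_simps)
  qed (use c in simp)
  define F where "F = (\<lambda>i x. real_of_ereal (f i (P i (Q x))))"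
  have F: "f i (P i (Q x)) = ereal (F i x)" if "i \<in> I" for i x
    using subdifferential_finite[OF A(5) P, OF that that] by (simp add: F_def ereal_real)
  \<comment> \<open>the proximal average plus \<open>|.|\<^sup>2/(2\<mu>)\<close>\<close>
  define H where "H = (\<lambda>x. \<Sum>i\<in>I. w i * (F i x + (norm (P i (Q x)))\<^sup>2 / (2 * \<mu>)))"
  define p where "p = proximal_average \<mu> I f w"
  have p: "p x = ereal (H x - (norm x)\<^sup>2 / (2 * \<mu>))" for x
    unfolding p_def H_def
    by (rule proximal_average_eq[OF fin A(1,3,5) P F]) (auto simp: TQ[unfolded T_def])
  have H_sub: "H x + inner (y - x) (Q x) \<le> H y" for x y
  proof -
    have "inner (y - x) (Q x) = inner (T (Q y) - T (Q x)) (Q x)" by (simp add: TQ)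
    also have "\<dots> = (\<Sum>i\<in>I. w i * inner (P i (Q y) - P i (Q x)) (Q x))"
      by (simp add: T_def inner_diff_left inner_sum_left sum_subtractf right_diff_distrib)
    finally have "H x + inner (y - x) (Q x) = (\<Sum>i\<in>I. w i * (F i x + (norm (P i (Q x)))\<^sup>2 / (2 * \<mu>)
        + inner (P i (Q y) - P i (Q x)) (Q x)))"
      by (simp add: H_def sum.distrib ring_distribs)
    also have "\<dots> \<le> H y"
      unfolding H_def
    proof (intro sum_mono mult_left_mono)
      fix i assume i: "i \<in> I"
      show "0 \<le> w i" using A(3)[OF i] by simp
      have "(\<mu> * F i x + (norm (P i (Q x)))\<^sup>2 / 2 + \<mu> * inner (P i (Q y) - P i (Q x)) (Q x)) / \<mu>
          \<le> (\<mu> * F i y + (norm (P i (Q y)))\<^sup>2 / 2) / \<mu>"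
        using regularized_supporting_affine[OF A(5)[OF i] A(1) P[OF i] F[OF i] F[OF i]] A(1)
        by (intro divide_right_mono) auto
      then show "F i x + (norm (P i (Q x)))\<^sup>2 / (2 * \<mu>) + inner (P i (Q y) - P i (Q x)) (Q x)
          \<le> F i y + (norm (P i (Q y)))\<^sup>2 / (2 * \<mu>)"
        using A(1) by (simp add: add_divide_distrib)
    qed
    finally show ?thesis .
  qed
  define R where "R = (\<lambda>x. Q x - (1 / \<mu>) *\<^sub>R x)"
  have G: "GDERIV (\<lambda>y. real_of_ereal (p y)) x :> R x" for x
    unfolding p R_def using A(1)
    by (auto intro!: GDERIV_diff GDERIV_of_lipschitz_subgradient[OF H_sub Q_lip] GDERIV_half_norm_sq)
  have grad: "gradient p = R" using gradient_eqI[OF G] by blast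
  have "frechet_differentiable p"
    unfolding frechet_differentiable_def
    using G[unfolded gderiv_def] by (auto simp: p differentiable_def)
  moreover have "resolvent_average \<mu> I (\<lambda>i. subdifferential (f i)) w x = {gradient p x}" for x
    unfolding grad R_def
    by (rule resolvent_average_eq[OF fin A(1,5) P]) (use QT in \<open>auto simp: T_def\<close>)
  moreover have "lipschitz_with (harmonic_const \<mu> I \<epsilon> w) (gradient p)"
  proof -
    have "harmonic_const \<mu> I \<epsilon> w = ereal (1 / c - 1 / \<mu>)"
      unfolding c_def
      by (rule harmonic_const_eq) (use fin A(1,9,12) c L0 L(1) in \<open>auto simp: c_def\<close>)
    moreover have "(1 / c - 1 / \<mu>)-lipschitz_on UNIV R"
    proof (rule GDERIV_monotone_imp_lipschitz[OF G])
      have "c \<le> (\<Sum>i\<in>I0. w i * \<mu>)"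
        unfolding c_def
      proof (rule sum_mono)
        fix i assume i: "i \<in> I0"
        have "1 \<le> \<mu> * (L i + 1 / \<mu>)" using L0[OF i] A(1) by (simp add: ring_distribs)
        then show "w i / (L i + 1 / \<mu>) \<le> w i * \<mu>"
          using den[OF i] w[OF i] by (simp add: divide_le_eq mult.assoc)
      qed
      also have "\<dots> \<le> (\<Sum>i\<in>I. w i * \<mu>)"
        using A(1,3) by (intro sum_mono2 fin A(9)) (simp add: less_imp_le)
      also have "\<dots> = \<mu>" using A(4) by (simp flip: sum_distrib_right)
      finally show "0 \<le> 1 / c - 1 / \<mu>" using c A(1) by (simp add: frac_le)
      have split: "inner (x - y) (R x - R y) = inner (x - y) (Q x - Q y) - (norm (x - y))\<^sup>2 / \<mu>" for x y
        by (simp add: R_def power2_norm_eq_inner inner_diff_left inner_diff_right diff_divide_distrib)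
      show "0 \<le> inner (x - y) (R x - R y)" for x y
        using Q_coco[of x y] by (simp add: split)
      have "inner (x - y) (Q x - Q y) \<le> norm (x - y) * (1 / c * norm (x - y))" for x y
      proof -
        have "inner (x - y) (Q x - Q y) \<le> norm (x - y) * norm (Q x - Q y)"
          by (rule norm_cauchy_schwarz)
        also have "\<dots> \<le> norm (x - y) * (1 / c * norm (x - y))"
          using lipschitz_onD[OF Q_lip, of x y] by (intro mult_left_mono) (auto simp: dist_norm)
        finally show ?thesis .
      qed
      then show "inner (x - y) (R x - R y) \<le> (1 / c - 1 / \<mu>) * (norm (x - y))\<^sup>2" for x y
        unfolding split by (simp add: left_diff_distrib power2_eq_square)
    qed
    ultimately show ?thesis by (auto simp: lipschitz_with_def grad)
  qed
  ultimately show ?thesis unfolding p_def I_def by blast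
qed

end
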